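(* Let $d\geq 2$ be an integer and let $e:(0,+\infty)\to(0,+\infty)$ be a function with $e(r)\leq r$ for all $r>0$. Assume that at least one of the following three hypotheses is satisfied: (h1) the function $e$ is non-decreasing and $\displaystyle\inf_{r>0}\frac{e(r)}{r}=0$; (h2) $\displaystyle\lim_{r\to+\infty}\frac{e(r)}{r}=0$; (h3) $\displaystyle\lim_{r\to0}\frac{e(r)}{r}=0$. Then, for every real $p$ with $1\leq p\leq\frac{d}{d-1}$, the family of averaging operators $(A_r)_{r>0}$ on the annuli $C_{r,e(r)}$ does not satisfy the weak-$L^p$ maximal inequality.
   Context: $\|\cdot\|$ is the Euclidean norm on $\mathbb{R}^d$ and $|A|$ is the Lebesgue measure of $A\subset\mathbb{R}^d$. For $0<e\leq r$, $C_{r,e}:=\{x\in\mathbb{R}^d\mid r-e\leq\|x\|\leq r\}$. A measure preserving system $(\Omega,\mathcal{T},\mu,(T_t)_{t\in\mathbb{R}^d})$ consists of a finite or $\sigma$-finite measure space $(\Omega,\mathcal{T},\mu)$ and a family of maps $T_t:\Omega\to\Omega$, $t\in\mathbb{R}^d$, such that $(t,\omega)\mapsto T_t(\omega)$ is measurable on $\mathbb{R}^d\times\Omega$, $\mu(T_t^{-1}(A))=\mu(A)$ for all $t\in\mathbb{R}^d$ and $A\in\mathcal{T}$, $T_0=\mathrm{Id}_\Omega$ and $T_{t+s}=T_t\circ T_s$ for all $t,s\in\mathbb{R}^d$. Given the thickness function $e$, set $$A_r\phi(\omega):=\frac1{|C_{r,e(r)}|}\int_{C_{r,e(r)}}\phi(T_t\omega)\,\mathrm{d}t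 .$$ For $p\in[1,+\infty)$, the family $(A_r)_{r>0}$ satisfies the weak-$L^p$ maximal inequality if there exists a finite constant $C(d,p)$ such that, for every measure preserving system $(\Omega,\mathcal{T},\mu,(T_t)_{t\in\mathbb{R}^d})$ and every $\phi\in L^p(\mu)$, $$\mu\left\{\omega\in\Omega\mid\sup_{r>0}|A_r\phi(\omega)|>1\right\}\leq C(d,p)\int_\Omega|\phi(\omega)|^p\,\mathrm{d}\mu(\omega).$$ *)

theory Defs
  imports "HOL-Analysis.Analysis"
begin

text \<open>
  A measure preserving action of the group \<open>\<real>\<^sup>d\<close>, with \<open>d = CARD('n)\<close>, on a \<open>\<sigma>\<close>-finite
  (in particular, possibly finite) measure space. Joint measurability refers to the Borel
  \<open>\<sigma>\<close>-algebra of \<open>\<real>\<^sup>d\<close>; it also says that each \<open>T t\<close> maps \<open>space M\<close> into itself.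
\<close>

locale measure_preserving_system = sigma_finite_measure M
  for M :: "'w measure" +
  fixes T :: "real ^ 'n \<Rightarrow> 'w \<Rightarrow> 'w"
  assumes measurable_action: "(\<lambda>(t, \<omega>). T t \<omega>) \<in> measurable (borel \<Otimes>\<^sub>M M) M"
    and measure_preserving: "\<And>t A. A \<in> sets M \<Longrightarrow> emeasure M (T t -` A \<inter> space M) = emeasure M A"
    and action_zero: "\<And>\<omega>. \<omega> \<in> space M \<Longrightarrow> T 0 \<omega> = \<omega>"
    and action_add: "\<And>t s \<omega>. \<omega> \<in> space M \<Longrightarrow> T (t + s) \<omega> = T t (T s \<omega>)"

definition annulus :: "real \<Rightarrow> real \<Rightarrow> (real ^ 'n) set" where
  "annulus r s = {x. r - s \<le> norm x \<and> norm x \<le> r}"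

definition annular_average ::
  "(real \<Rightarrow> real) \<Rightarrow> (real ^ 'n \<Rightarrow> 'w \<Rightarrow> 'w) \<Rightarrow> real \<Rightarrow> ('w \<Rightarrow> real) \<Rightarrow> 'w \<Rightarrow> real" where
  "annular_average e T r \<phi> \<omega> =
     1 / measure lborel (annulus r (e r) :: (real ^ 'n) set) *
     (LINT t:annulus r (e r)|lborel. \<phi> (T t \<omega>))"

text \<open>
  The weak-\<open>L\<^sup>p\<close> maximal inequality for all systems \<open>(M, T)\<close> whose points have type \<open>'w\<close>,
  with one constant \<open>C\<close> for all of them. The set where the maximal function exceeds 1 comes from an
  uncountable supremum, so it need not lie in \<open>sets M\<close>; its size is therefore taken with the outer
  measure induced by \<open>M\<close>, which agrees with \<open>emeasure M\<close> on \<open>sets M\<close>. The supremum is taken in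
  the extended non-negative reals, so it may be infinite.
\<close>

definition weak_Lp_maximal_inequality ::
  "'w itself \<Rightarrow> 'n::finite itself \<Rightarrow> (real \<Rightarrow> real) \<Rightarrow> real \<Rightarrow> bool" where
  "weak_Lp_maximal_inequality _ _ e p \<longleftrightarrow>
     (\<exists>C\<ge>0. \<forall>(M :: 'w measure) (T :: real ^ 'n \<Rightarrow> 'w \<Rightarrow> 'w) (\<phi> :: 'w \<Rightarrow> real).
        measure_preserving_system M T \<longrightarrow>
        \<phi> \<in> borel_measurable M \<longrightarrow> integrable M (\<lambda>\<omega>. \<bar>\<phi> \<omega>\<bar> powr p) \<longrightarrow>
        outer_measure_of M
          {\<omega> \<in> space M. (SUP r\<in>{0<..}. ennreal \<bar>annular_average e T r \<phi> \<omega>\<bar>) > 1}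
        \<le> ennreal (C * (LINT \<omega>|M. \<bar>\<phi> \<omega>\<bar> powr p)))"

end

theory Submission
  imports Defs
begin

text \<open>
  Each hypothesis provides scales \<open>R\<close> such that \<open>e r / r\<close> is arbitrarily small for all
  \<open>r \<in> {R..2 * R}\<close>. Let \<open>\<real>\<^sup>d\<close> act on itself by translations. For \<open>R \<le> norm x \<le> 2 * R\<close> the
  annulus of outer radius \<open>norm x\<close> around \<open>x\<close> passes through the origin, and it meets the ball of
  radius \<open>\<rho>\<close> around the origin in at least a proportion \<open>c * (\<rho> / R) ^ (d - 1)\<close> of its measure, however
  thin it is, provided \<open>\<rho>\<close> exceeds its thickness. Test the inequality on the function with the value
  \<open>2 ^ (k * (d - 1)) / k\<close> on the shell \<open>R / 2 ^ k / 2 < norm y \<le> R / 2 ^ k\<close>, for \<open>1 \<le> k \<le> N\<close>: its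
  averages at all these \<open>x\<close> are at least a multiple of the harmonic number of \<open>N\<close>, while
  the integral of its \<open>p\<close>-th power is at most a multiple of \<open>R ^ d * (\<Sum>k. k powr - (d / (d - 1)))\<close>,
  a bound that does not depend on \<open>N\<close>.
\<close>

section \<open>Cones generated by a ball around a unit vector\<close>

text \<open>Written as a union of balls, so that openness is immediate and a dilation only rescales
  \<open>s\<close>.\<close>

definition cone_over_ball :: "'a::real_normed_vector \<Rightarrow> real \<Rightarrow> 'a set" where
  "cone_over_ball m \<eta> = (\<Union>s\<in>{0<..}. ball (s *\<^sub>R m) (s * \<eta>))"

lemma open_cone_over_ball: "open (cone_over_ball m \<eta>)"
  unfolding cone_over_ball_def by auto

lemma cone_over_ball_scaleR:
  assumes "c > 0" "t \<in> cone_over_ball m \<eta>"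
  shows "c *\<^sub>R t \<in> cone_over_ball m \<eta>"
proof -
  obtain s where s: "s > 0" "dist (s *\<^sub>R m) t < s * \<eta>"
    using assms(2) by (auto simp: cone_over_ball_def)
  have "dist ((c * s) *\<^sub>R m) (c *\<^sub>R t) = c * dist (s *\<^sub>R m) t"
    using assms(1) by (simp add: dist_norm flip: scaleR_scaleR scaleR_diff_right)
  then have "dist ((c * s) *\<^sub>R m) (c *\<^sub>R t) < c * s * \<eta>"
    using s assms(1) by simp
  then show ?thesis
    using s assms(1) unfolding cone_over_ball_def by (auto intro!: bexI[of _ "c * s"])
qed

text \<open>Dividing \<open>t\<close> by the parameter \<open>s\<close> of its ball gives
  \<open>u\<close> in \<open>ball m \<eta>\<close>. Normalising \<open>u\<close> moves it by
  \<open>\<bar>1 - norm u\<bar>\<close>, again at most its distance from \<open>m\<close>; hence the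
  factor 2. The bound \<open>\<eta> \<le> 1\<close> keeps the origin out of the open balls.\<close>

lemma cone_over_ball_direction:
  fixes m t :: "'a::real_normed_vector"
  assumes m: "norm m = 1" and "\<eta> \<le> 1" and t: "t \<in> cone_over_ball m \<eta>"
  shows "t \<noteq> 0" "norm (t /\<^sub>R norm t - m) < 2 * \<eta>"
proof -
  obtain s where s: "s > 0" "dist (s *\<^sub>R m) t < s * \<eta>"
    using t by (auto simp: cone_over_ball_def)
  show t0: "t \<noteq> 0"
    using s m mult_left_mono[OF \<open>\<eta> \<le> 1\<close>, of s] by (auto simp: dist_norm)
  define u where "u = t /\<^sub>R s"
  have "s * norm (u - m) = norm (s *\<^sub>R (u - m))"
    using s by simp
  also have "\<dots> = dist (s *\<^sub>R m) t"
    using s by (simp add: u_def dist_norm norm_minus_commute algebra_simps)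
  finally have u: "norm (u - m) < \<eta>"
    using s by (metis mult_less_cancel_left_pos)
  have u0: "u \<noteq> 0" using t0 s by (simp add: u_def)
  have "norm (u /\<^sub>R norm u - u) = norm ((1 / norm u - 1) *\<^sub>R u)"
    by (simp add: algebra_simps divide_inverse)
  also have "\<dots> = \<bar>1 - norm u\<bar>"
    using u0 by (simp add: field_simps flip: abs_mult_pos)
  also have "\<dots> \<le> norm (u - m)"
    using norm_triangle_ineq3[of u m] m by simp
  finally have "norm (u /\<^sub>R norm u - u) < \<eta>" using u by simp
  moreover have "u /\<^sub>R norm u = t /\<^sub>R norm t"
    using s by (simp add: u_def)
  ultimately show "norm (t /\<^sub>R norm t - m) < 2 * \<eta>"
    using u norm_triangle_ineq[of "t /\<^sub>R norm t - u" "u - m"] by simp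
qed

section \<open>Volumes of cones inside balls and annuli\<close>

lemma emeasure_lborel_Int_ball_finite:
  fixes A :: "'a::euclidean_space set"
  shows "emeasure lborel (A \<inter> ball a r) < \<infinity>"
  using emeasure_bounded_finite[of "A \<inter> ball a r"] by (metis bounded_Int bounded_ball)

text \<open>The cone contains about \<open>1/\<eta>\<close> disjoint balls of radius \<open>\<eta>/4\<close>, lined up along its axis.\<close>

lemma measure_cone_over_ball_ge:
  fixes m :: "'a::euclidean_space"
  assumes m: "norm m = 1" and \<eta>: "0 < \<eta>" "\<eta> \<le> 1"
  shows "unit_ball_vol DIM('a) * (\<eta>/4) ^ DIM('a) / (2 * \<eta>)
           \<le> measure lborel (cone_over_ball m \<eta> \<inter> ball 0 1)"
proof -
  \<comment> \<open>The centres lie between \<open>1/4\<close> and \<open>1/2\<close> on the axis,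
    where the cone has room for balls of radius \<open>\<eta>/4\<close>. Their spacing
    \<open>\<eta>/2\<close> is the sum of two radii.\<close>
  define J where "J = nat \<lfloor>1 / (2 * \<eta>)\<rfloor>"
  define s where "s j = 1/4 + real j * \<eta> / 2" for j
  define B where "B j = ball (s j *\<^sub>R m) (\<eta>/4)" for j
  have J: "real J \<le> 1 / (2 * \<eta>)" "1 / (2 * \<eta>) \<le> real J + 1"
    unfolding J_def using \<eta> by (simp_all add: floor_le_iff)
  have s: "1/4 \<le> s j" "s j \<le> 1/2" if "j \<le> J" for j
  proof -
    have "real j \<le> 1 / (2 * \<eta>)" using that J by linarith
    then have "real j * \<eta> \<le> 1/2" using \<eta> by (simp add: field_simps)
    then show "1/4 \<le> s j" "s j \<le> 1/2" using \<eta> by (auto simp: s_def)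
  qed
  have sub: "(\<Union>j\<le>J. B j) \<subseteq> cone_over_ball m \<eta> \<inter> ball 0 1"
  proof safe
    fix j x assume j: "j \<le> J" and x: "x \<in> B j"
    have "\<eta> / 4 \<le> s j * \<eta>" using s[OF j] \<eta> by simp
    then show "x \<in> cone_over_ball m \<eta>"
      using x s[OF j] unfolding cone_over_ball_def B_def
      by (intro UN_I[of "s j"]) auto
    have "norm x \<le> norm (s j *\<^sub>R m) + dist (s j *\<^sub>R m) x"
      by (metis dist_0_norm dist_triangle)
    also have "\<dots> < s j + \<eta>/4"
      using x m s[OF j] by (simp add: B_def)
    also have "\<dots> \<le> 1" using s[OF j] \<eta> by simp
    finally show "x \<in> ball 0 1" by simp
  qed
  have disj: "disjoint_family_on B {..J}"
    unfolding disjoint_family_on_def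
  proof (intro ballI impI)
    fix i j :: nat assume "i \<noteq> j"
    have "\<eta>/2 \<le> \<bar>real i - real j\<bar> * (\<eta>/2)"
      using \<open>i \<noteq> j\<close> \<eta> by (simp add: field_simps)
    also have "\<dots> = \<bar>(real i - real j) * (\<eta>/2)\<bar>"
      using \<eta> by (simp add: abs_mult)
    also have "\<dots> = \<bar>s i - s j\<bar>"
      by (simp add: s_def algebra_simps diff_divide_distrib)
    also have "\<dots> = dist (s i *\<^sub>R m) (s j *\<^sub>R m)"
      using m by (simp add: dist_norm flip: scaleR_diff_left)
    finally have "\<eta>/4 + \<eta>/4 \<le> dist (s i *\<^sub>R m) (s j *\<^sub>R m)" by simp
    then show "B i \<inter> B j = {}"
      unfolding B_def by (rule disjoint_ballI)
  qed
  \<comment> \<open>Counting from \<open>j = 0\<close> gives \<open>J + 1\<close> balls, which makes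
    up for rounding \<open>1 / (2 * \<eta>)\<close> down.\<close>
  have "unit_ball_vol DIM('a) * (\<eta>/4) ^ DIM('a) / (2 * \<eta>)
      = 1 / (2 * \<eta>) * (unit_ball_vol DIM('a) * (\<eta>/4) ^ DIM('a))" by simp
  also have "\<dots> \<le> (real J + 1) * (unit_ball_vol DIM('a) * (\<eta>/4) ^ DIM('a))"
    using J \<eta> by (intro mult_right_mono) auto
  also have "\<dots> = (\<Sum>j\<le>J. measure lborel (B j))"
    using \<eta> by (simp add: B_def content_ball)
  also have "\<dots> = measure lborel (\<Union>j\<le>J. B j)"
  proof (rule measure_finite_Union[symmetric])
    show "emeasure lborel (B j) \<noteq> \<infinity>" for j
      using \<eta> by (simp add: B_def emeasure_ball)
    show "B ` {..J} \<subseteq> sets lborel" by (auto simp: B_def)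
  qed (use disj in auto)
  also have "\<dots> \<le> measure lborel (cone_over_ball m \<eta> \<inter> ball 0 1)"
    using sub emeasure_lborel_Int_ball_finite
    by (intro measure_mono_fmeasurable)
       (auto simp: fmeasurable_def B_def open_cone_over_ball intro: borel_open)
  finally show ?thesis .
qed

text \<open>The dilation by \<open>r\<close> maps \<open>K\<close> onto itself and the unit ball
  onto \<open>ball 0 r\<close>.\<close>

lemma measure_lborel_cone_Int_ball:
  fixes K :: "'a::euclidean_space set"
  assumes K: "K \<in> sets borel" "\<And>c t. c > 0 \<Longrightarrow> t \<in> K \<Longrightarrow> c *\<^sub>R t \<in> K" and r: "r > 0"
  shows "measure lborel (K \<inter> ball 0 r) = r ^ DIM('a) * measure lborel (K \<inter> ball 0 1)"
proof -
  have "K \<inter> ball 0 r = (\<lambda>x. r *\<^sub>R x + 0) ` (K \<inter> ball 0 1)"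
  proof safe
    fix x assume x: "x \<in> K" "x \<in> ball 0 r"
    have "x = r *\<^sub>R (x /\<^sub>R r) + 0" "x /\<^sub>R r \<in> K \<inter> ball 0 1"
      using x r K(2)[of "inverse r" x] by (auto simp: field_simps)
    then show "x \<in> (\<lambda>x. r *\<^sub>R x + 0) ` (K \<inter> ball 0 1)" by blast
  qed (use r K(2) in \<open>auto simp: field_simps\<close>)
  then have "measure lebesgue (K \<inter> ball 0 r) = r ^ DIM('a) * measure lebesgue (K \<inter> ball 0 1)"
    using measure_lebesgue_affine[of r "0::'a" "K \<inter> ball 0 1"] r by simp
  moreover have "K \<inter> ball 0 r \<in> sets lborel" "K \<inter> ball 0 1 \<in> sets lborel"
    using K(1) by auto
  ultimately show ?thesis
    by (simp only: measure_completion)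
qed

text \<open>Subtract the scaling law at the two radii. The difference of the open balls omits only
  the outer sphere of the annulus, so the inequality follows without computing the measure of a
  sphere.\<close>

lemma measure_lborel_cone_Int_annulus_ge:
  fixes K :: "'a::euclidean_space set"
  assumes K: "K \<in> sets borel" "\<And>c t. c > 0 \<Longrightarrow> t \<in> K \<Longrightarrow> c *\<^sub>R t \<in> K" and r: "0 < s" "s < r"
  shows "(r ^ DIM('a) - (r - s) ^ DIM('a)) * measure lborel (K \<inter> ball 0 1)
           \<le> measure lborel (K \<inter> {t. r - s \<le> norm t \<and> norm t \<le> r})"
proof -
  have "(r ^ DIM('a) - (r - s) ^ DIM('a)) * measure lborel (K \<inter> ball 0 1)
      = measure lborel (K \<inter> ball 0 r) - measure lborel (K \<inter> ball 0 (r - s))"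
    using r measure_lborel_cone_Int_ball[OF K, where r = r]
      measure_lborel_cone_Int_ball[OF K, where r = "r - s"]
    by (simp only: left_diff_distrib diff_gt_0_iff_gt less_trans)
  also have "\<dots> = measure lborel ((K \<inter> ball 0 r) - (K \<inter> ball 0 (r - s)))"
    using K(1) r emeasure_lborel_Int_ball_finite[of K 0 r]
    by (intro measure_Diff[symmetric]) auto
  also have "\<dots> \<le> measure lborel (K \<inter> {t. r - s \<le> norm t \<and> norm t \<le> r})"
  proof (rule measure_mono_fmeasurable)
    have "bounded (K \<inter> {t. r - s \<le> norm t \<and> norm t \<le> r})"
      by (rule boundedI[of _ r]) auto
    then show "K \<inter> {t. r - s \<le> norm t \<and> norm t \<le> r} \<in> fmeasurable lborel"
      using K(1) emeasure_bounded_finite by (auto simp: fmeasurable_def)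
  qed (use K(1) in auto)
  finally show ?thesis .
qed

lemma measure_annulus:
  fixes r s :: real
  assumes "0 < s" "s < r"
  shows "measure lborel (annulus r s :: (real ^ 'n) set)
    = (r ^ CARD('n) - (r - s) ^ CARD('n)) * unit_ball_vol CARD('n)"
proof -
  have "annulus r s = cball 0 r - (ball 0 (r - s) :: (real ^ 'n) set)"
    by (auto simp: annulus_def)
  moreover have "measure lborel (cball 0 r - (ball 0 (r - s) :: (real ^ 'n) set))
      = measure lborel (cball 0 r :: (real ^ 'n) set) - measure lborel (ball 0 (r - s) :: (real ^ 'n) set)"
    using assms by (intro measure_Diff) (auto simp: emeasure_cball)
  ultimately show ?thesis
    using assms by (simp add: content_ball content_cball algebra_simps)
qed

section \<open>Thin annuli through the origin meeting shells around it\<close>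

lemma exists_unit_vector_at_dist:
  fixes n :: "'a::euclidean_space"
  assumes "2 \<le> DIM('a)" "norm n = 1" "0 \<le> b" "b \<le> 2"
  obtains m where "norm m = 1" "norm (m - n) = b"
proof -
  obtain w where w: "w \<noteq> 0" "orthogonal n w"
    using orthogonal_to_vector_exists[OF assms(1)] .
  define v where "v = w /\<^sub>R norm w"
  have v: "v \<bullet> v = 1" "n \<bullet> v = 0" "n \<bullet> n = 1"
    using w assms(2) by (simp_all add: v_def orthogonal_def dot_square_norm power2_eq_square)
  \<comment> \<open>\<open>m\<close> is \<open>n\<close> rotated in the plane of \<open>n\<close>
    and \<open>v\<close> by the angle whose chord is \<open>b\<close>: its cosine is
    \<open>1 - b\<^sup>2/2\<close> and its sine is \<open>b * c\<close>.\<close>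
  define c where "c = sqrt (1 - b\<^sup>2/4)"
  have "b\<^sup>2 \<le> 2\<^sup>2" using assms by (intro power_mono) auto
  then have c: "c\<^sup>2 = 1 - b\<^sup>2/4" by (simp add: c_def)
  define m where "m = (1 - b\<^sup>2/2) *\<^sub>R n + (b * c) *\<^sub>R v"
  have "m \<bullet> m = (1 - b\<^sup>2/2)\<^sup>2 + b\<^sup>2 * c\<^sup>2"
    using v by (simp add: m_def inner_add inner_commute power2_eq_square)
  then have 1: "m \<bullet> m = 1" unfolding c by (simp add: power2_eq_square algebra_simps)
  have mn: "m - n = (- (b\<^sup>2/2)) *\<^sub>R n + (b * c) *\<^sub>R v"
    by (simp add: m_def algebra_simps)
  have "(m - n) \<bullet> (m - n) = (b\<^sup>2/2)\<^sup>2 + b\<^sup>2 * c\<^sup>2"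
    unfolding mn using v by (simp add: inner_diff inner_add inner_commute power2_eq_square)
  then have 2: "(m - n) \<bullet> (m - n) = b\<^sup>2" unfolding c by (simp add: power2_eq_square algebra_simps)
  show ?thesis
  proof (rule that[of m])
    show "norm m = 1" using 1 by (simp add: norm_eq_sqrt_inner)
    show "norm (m - n) = b" using 2 assms by (simp add: norm_eq_sqrt_inner)
  qed
qed

text \<open>Both the annulus and its part in a cone with apex at its centre have measure proportional to
  \<open>r\<^sup>d - (r - s)\<^sup>d\<close>, so the thickness \<open>s\<close> drops out of the proportion.\<close>

lemma measure_annulus_Int_shell_ge:
  fixes x :: "real ^ 'n"
  assumes d: "CARD('n) \<ge> 2" and s: "0 < s" "s \<le> \<rho> / 8" and \<rho>: "\<rho> \<le> norm x"
  shows "(\<rho> / norm x) ^ (CARD('n) - 1) / (2 * 4 ^ CARD('n) * 16 ^ (CARD('n) - 1))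
           * measure lborel (annulus (norm x) s :: (real ^ 'n) set)
       \<le> measure lborel (annulus (norm x) s \<inter> {t. \<rho> / 2 < norm (x + t) \<and> norm (x + t) \<le> \<rho>})"
proof -
  define r where "r = norm x"
  have r: "0 < \<rho>" "\<rho> \<le> r" "0 < r" "s < r" using s \<rho> unfolding r_def by linarith+
  define \<tau> where "\<tau> = \<rho> / r"
  have \<tau>: "0 < \<tau>" "\<tau> \<le> 1" using r by (auto simp: \<tau>_def)
  \<comment> \<open>The direction from \<open>x\<close> to the origin:
    \<open>x + r *\<^sub>R n = 0\<close>.\<close>
  define n where "n = - (x /\<^sub>R r)"
  have n: "norm n = 1" using r by (simp add: n_def r_def)
  have x: "x = - (r *\<^sub>R n)" using r by (simp add: n_def)
  \<comment> \<open>In direction \<open>m\<close> the point \<open>x + r *\<^sub>R m\<close> is at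
    distance \<open>3/4 * \<rho>\<close> from the origin, the middle of the shell. Directions in the
    cone of aperture \<open>\<tau> / 16\<close> change this by less than \<open>\<rho> / 8\<close>,
    and the thickness of the annulus by at most another \<open>\<rho> / 8\<close>.\<close>
  obtain m where m: "norm m = 1" "norm (m - n) = 3/4 * \<tau>"
    by (rule exists_unit_vector_at_dist[of n "3/4 * \<tau>"]) (use d n \<tau> in auto)
  define \<eta> where "\<eta> = \<tau> / 16"
  have \<eta>: "0 < \<eta>" "\<eta> \<le> 1" using \<tau> by (auto simp: \<eta>_def)
  define K where "K = cone_over_ball m \<eta>"
  have K: "K \<in> sets borel" "\<And>c t. c > 0 \<Longrightarrow> t \<in> K \<Longrightarrow> c *\<^sub>R t \<in> K"
    unfolding K_def by (auto intro: borel_open open_cone_over_ball cone_over_ball_scaleR)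
  have sub: "K \<inter> {t. r - s \<le> norm t \<and> norm t \<le> r}
      \<subseteq> annulus r s \<inter> {t. \<rho> / 2 < norm (x + t) \<and> norm (x + t) \<le> \<rho>}"
  proof
    fix t assume t: "t \<in> K \<inter> {t. r - s \<le> norm t \<and> norm t \<le> r}"
    define u where "u = t /\<^sub>R norm t"
    have t0: "t \<noteq> 0" and u: "norm (u - m) < 2 * \<eta>"
      using t cone_over_ball_direction[OF m(1) \<eta>(2)] by (auto simp: K_def u_def)
    have "\<bar>norm (u - n) - norm (m - n)\<bar> \<le> norm (u - m)"
      using norm_triangle_ineq3[of "u - n" "m - n"] by simp
    then have un: "5/8 * \<tau> < norm (u - n)" "norm (u - n) < 7/8 * \<tau>"
      using u m(2) unfolding \<eta>_def by linarith+
    have "norm (x + r *\<^sub>R u) = norm (r *\<^sub>R (u - n))"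
      by (simp add: x algebra_simps)
    then have xu: "norm (x + r *\<^sub>R u) = r * norm (u - n)" using r by simp
    have tu: "t = norm t *\<^sub>R u" using t0 by (simp add: u_def)
    have nu: "norm u = 1" using t0 by (simp add: u_def)
    have "norm (t - r *\<^sub>R u) = norm ((norm t - r) *\<^sub>R u)"
      by (subst tu) (simp add: algebra_simps)
    also have "\<dots> = \<bar>norm t - r\<bar>" using nu by simp
    also have "\<dots> \<le> \<rho> / 8" using t s by auto
    finally have "\<bar>norm (x + t) - norm (x + r *\<^sub>R u)\<bar> \<le> \<rho> / 8"
      using norm_triangle_ineq3[of "x + t" "x + r *\<^sub>R u"] by simp
    moreover have "5/8 * \<rho> < r * norm (u - n)" "r * norm (u - n) < 7/8 * \<rho>"
      using un r by (simp_all add: \<tau>_def field_simps)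
    ultimately have "\<rho> / 2 < norm (x + t)" "norm (x + t) \<le> \<rho>"
      using xu by linarith+
    then show "t \<in> annulus r s \<inter> {t. \<rho> / 2 < norm (x + t) \<and> norm (x + t) \<le> \<rho>}"
      using t unfolding annulus_def by auto
  qed
  obtain k where k: "CARD('n) = Suc k" using d by (cases "CARD('n)") auto
  define \<delta> where "\<delta> = r ^ CARD('n) - (r - s) ^ CARD('n)"
  have \<delta>: "0 \<le> \<delta>" using r s by (auto simp: \<delta>_def intro: power_mono)
  \<comment> \<open>The number of balls along the axis cancels one factor \<open>\<eta>\<close>,
    which leaves the exponent \<open>d - 1\<close>.\<close>
  have "\<tau> ^ (CARD('n) - 1) / (2 * 4 ^ CARD('n) * 16 ^ (CARD('n) - 1)) * (\<delta> * unit_ball_vol CARD('n))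
      = \<delta> * (unit_ball_vol CARD('n) * (\<eta>/4) ^ CARD('n) / (2 * \<eta>))"
  proof -
    have "(64::real) ^ k = 4 ^ k * 16 ^ k" by (simp flip: power_mult_distrib)
    then show ?thesis using \<tau> unfolding \<eta>_def k by (simp add: power_divide mult_ac)
  qed
  also have "\<dots> \<le> \<delta> * measure lborel (K \<inter> ball 0 1)"
    using measure_cone_over_ball_ge[OF m(1) \<eta>] \<delta> by (intro mult_left_mono) (simp_all add: K_def)
  also have "\<dots> \<le> measure lborel (K \<inter> {t. r - s \<le> norm t \<and> norm t \<le> r})"
    using measure_lborel_cone_Int_annulus_ge[OF K s(1) r(4)] by (simp add: \<delta>_def)
  also have "\<dots> \<le> measure lborel (annulus r s \<inter> {t. \<rho> / 2 < norm (x + t) \<and> norm (x + t) \<le> \<rho>})"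
  proof (rule measure_mono_fmeasurable[OF sub])
    have "bounded (annulus r s \<inter> {t. \<rho> / 2 < norm (x + t) \<and> norm (x + t) \<le> \<rho>})"
      by (rule boundedI[of _ r]) (auto simp: annulus_def)
    then show "annulus r s \<inter> {t. \<rho> / 2 < norm (x + t) \<and> norm (x + t) \<le> \<rho>} \<in> fmeasurable lborel"
      unfolding annulus_def using emeasure_bounded_finite by (auto simp: fmeasurable_def)
  qed (use K(1) in auto)
  finally show ?thesis
    using measure_annulus[OF s(1) r(4), where 'n='n] unfolding \<delta>_def r_def \<tau>_def by simp
qed

section \<open>Scales at which the annuli are thin\<close>

text \<open>In each case \<open>e r / r\<close> is first made smaller than
  \<open>\<epsilon> / 2\<close>, at one radius or on a whole range; the spare factor 2 pays for
  replacing a radius up to \<open>2 * R\<close> by \<open>R\<close>.\<close>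

lemma exists_thin_scale:
  fixes e :: "real \<Rightarrow> real"
  assumes e: "\<And>r. r > 0 \<Longrightarrow> 0 < e r \<and> e r \<le> r"
    and h: "(mono_on {0<..} e \<and> (INF r\<in>{0<..}. e r / r) = 0)
         \<or> ((\<lambda>r. e r / r) \<longlongrightarrow> 0) at_top
         \<or> ((\<lambda>r. e r / r) \<longlongrightarrow> 0) (at_right 0)"
    and \<epsilon>: "\<epsilon> > 0"
  obtains R where "R > 0" "\<And>r. R \<le> r \<Longrightarrow> r \<le> 2 * R \<Longrightarrow> e r \<le> \<epsilon> * R"
proof -
  have "\<exists>R>0. \<forall>r. R \<le> r \<and> r \<le> 2 * R \<longrightarrow> e r \<le> \<epsilon> * R"
    using h
  proof (elim disjE conjE)
    assume mono: "mono_on {0<..} e" and inf: "(INF r\<in>{0<..}. e r / r) = 0"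
    have "bdd_below ((\<lambda>r. e r / r) ` {0<..})"
      by (rule bdd_belowI[of _ 0]) (use e in \<open>auto simp: less_imp_le\<close>)
    then obtain q where q: "q > 0" "e q / q < \<epsilon> / 2"
      using inf \<epsilon> cInf_less_iff[of "(\<lambda>r. e r / r) ` {0<..}" "\<epsilon> / 2"] by auto
    \<comment> \<open>With \<open>R = q / 2\<close> the good radius \<open>q\<close> is the right
      end of the interval, and monotonicity carries its bound to all smaller radii.\<close>
    have "e r \<le> \<epsilon> * (q / 2)" if "q / 2 \<le> r" "r \<le> 2 * (q / 2)" for r
    proof -
      have "e r \<le> e q" using that q by (intro mono_onD[OF mono]) auto
      also have "\<dots> \<le> \<epsilon> * (q / 2)" using q by (simp add: field_simps)
      finally show ?thesis .
    qed
    then show ?thesis using q by (intro exI[of _ "q / 2"]) auto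
  next
    assume "((\<lambda>r. e r / r) \<longlongrightarrow> 0) at_top"
    then have "\<forall>\<^sub>F r in at_top. e r / r < \<epsilon> / 2"
      using \<epsilon> by (intro order_tendstoD(2)) auto
    then obtain N where N: "\<And>r. r \<ge> N \<Longrightarrow> e r / r < \<epsilon> / 2"
      by (auto simp: eventually_at_top_linorder)
    define R where "R = max N 1"
    have "e r \<le> \<epsilon> * R" if "R \<le> r" "r \<le> 2 * R" for r
    proof -
      have "r > 0" "r \<ge> N" using that by (auto simp: R_def)
      then have "e r \<le> \<epsilon> / 2 * r" using N[of r] by (simp add: field_simps)
      also have "\<dots> \<le> \<epsilon> / 2 * (2 * R)" using that \<epsilon> by (intro mult_left_mono) auto
      finally show ?thesis by simp
    qed
    then show ?thesis by (intro exI[of _ R]) (auto simp: R_def)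
  next
    assume "((\<lambda>r. e r / r) \<longlongrightarrow> 0) (at_right 0)"
    then have "\<forall>\<^sub>F r in at_right 0. e r / r < \<epsilon> / 2"
      using \<epsilon> by (intro order_tendstoD(2)) auto
    then obtain N where N: "N > 0" "\<And>r. 0 < r \<Longrightarrow> r < N \<Longrightarrow> e r / r < \<epsilon> / 2"
      by (auto simp: eventually_at_right_field)
    \<comment> \<open>Dividing by 3 keeps \<open>2 * R\<close> strictly below
      \<open>N\<close>.\<close>
    define R where "R = N / 3"
    have "e r \<le> \<epsilon> * R" if "R \<le> r" "r \<le> 2 * R" for r
    proof -
      have "r > 0" "r < N" using that N by (auto simp: R_def)
      then have "e r \<le> \<epsilon> / 2 * r" using N(2)[of r] by (simp add: field_simps)
      also have "\<dots> \<le> \<epsilon> / 2 * (2 * R)" using that \<epsilon> by (intro mult_left_mono) auto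
      finally show ?thesis by simp
    qed
    then show ?thesis using N by (intro exI[of _ R]) (auto simp: R_def)
  qed
  then show ?thesis using that by blast
qed

section \<open>The test function and the integral of its \<open>p\<close>-th power\<close>

text \<open>Half-open, so that neighbouring shells do not share a sphere.\<close>

definition dyadic_shell :: "real \<Rightarrow> nat \<Rightarrow> (real ^ 'n) set" where
  "dyadic_shell R k = {y. R / 2 ^ k / 2 < norm y \<and> norm y \<le> R / 2 ^ k}"

text \<open>A truncation of \<open>norm y powr (1 - d) / log (1 / norm y)\<close>, which lies in \<open>L\<^sup>p\<close> near the origin
  up to the critical exponent \<open>d / (d - 1)\<close>, although its integral over a sphere through the
  origin diverges.\<close>

definition critical_function :: "real \<Rightarrow> nat \<Rightarrow> real ^ 'n \<Rightarrow> real" where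
  "critical_function R N y =
     (\<Sum>k=1..N. 2 ^ (k * (CARD('n) - 1)) / real k * indicator (dyadic_shell R k) y)"

lemma dyadic_shell_borel [measurable]: "dyadic_shell R k \<in> sets borel"
  unfolding dyadic_shell_def by measurable

lemma critical_function_borel [measurable]: "critical_function R N \<in> borel_measurable borel"
  unfolding critical_function_def[abs_def] by measurable

lemma dyadic_shell_unique:
  assumes "y \<in> dyadic_shell R j" "y \<in> dyadic_shell R k"
  shows "j = k"
proof -
  have False if "y \<in> dyadic_shell R j" "y \<in> dyadic_shell R k" "j < k" for j k
  proof -
    have y: "norm y \<le> R / 2 ^ k" "R / 2 ^ j / 2 < norm y"
      using that by (auto simp: dyadic_shell_def)
    have "(2::real) ^ Suc j \<le> 2 ^ k"
      using \<open>j < k\<close> by (intro power_increasing) auto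
    \<comment> \<open>A nonempty shell forces this sign, and the comparison of quotients relies on
      it.\<close>
    moreover have "0 \<le> R"
      using order_trans[OF norm_ge_zero y(1)] divide_neg_pos[of R "2 ^ k"] by fastforce
    ultimately have "R / 2 ^ k \<le> R / 2 ^ Suc j"
      by (intro divide_left_mono) auto
    then show False using y by simp
  qed
  then show ?thesis using assms by (metis nat_neq_iff)
qed

lemma measure_dyadic_shell_le:
  assumes "R > 0"
  shows "measure lborel (dyadic_shell R k :: (real ^ 'n) set)
    \<le> unit_ball_vol CARD('n) * (R / 2 ^ k) ^ CARD('n)"
proof -
  have "measure lborel (dyadic_shell R k :: (real ^ 'n) set)
      \<le> measure lborel (cball 0 (R / 2 ^ k) :: (real ^ 'n) set)"
    using emeasure_bounded_finite[OF bounded_cball]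
    by (intro measure_mono_fmeasurable) (auto simp: dyadic_shell_def fmeasurable_def)
  then show ?thesis using assms by (simp add: content_cball)
qed

lemma integrable_indicator_dyadic_shell:
  "integrable lborel (indicator (dyadic_shell R k) :: real ^ 'n \<Rightarrow> real)"
proof -
  have "bounded (dyadic_shell R k :: (real ^ 'n) set)"
    by (rule boundedI[of _ "R / 2 ^ k"]) (auto simp: dyadic_shell_def)
  then show ?thesis
    using emeasure_bounded_finite by (intro integrable_real_indicator) auto
qed

text \<open>At most one shell contains \<open>y\<close>, so the power can be taken term by
  term.\<close>

lemma critical_function_powr:
  assumes "p > 0"
  shows "\<bar>critical_function R N (y :: real ^ 'n)\<bar> powr p =
    (\<Sum>k=1..N. (2 ^ (k * (CARD('n) - 1)) / real k) powr p * indicator (dyadic_shell R k) y)"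
proof (cases "\<exists>k\<in>{1..N}. y \<in> dyadic_shell R k")
  case True
  then obtain k where k: "k \<in> {1..N}" "y \<in> dyadic_shell R k" by blast
  \<comment> \<open>For arbitrary \<open>a\<close>, to cover both the coefficients and their
    \<open>p\<close>-th powers.\<close>
  have *: "(\<Sum>j=1..N. a j * indicator (dyadic_shell R j) y) = a k" for a :: "nat \<Rightarrow> real"
  proof -
    have "(\<Sum>j=1..N. a j * indicator (dyadic_shell R j) y) = (\<Sum>j=1..N. if j = k then a j else 0)"
      using k(2) dyadic_shell_unique[of y R] by (intro sum.cong) (auto simp: indicator_def)
    then show ?thesis using k(1) by simp
  qed
  show ?thesis unfolding critical_function_def * by simp
next
  case False
  then have *: "(\<Sum>j=1..N. a j * indicator (dyadic_shell R j) y) = 0" for a :: "nat \<Rightarrow> real"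
    by (intro sum.neutral) (auto simp: indicator_def)
  show ?thesis using assms unfolding critical_function_def * by simp
qed

text \<open>The coefficient is at least 1, so its powers increase with the exponent and the critical
  \<open>d / (d - 1)\<close> is the worst case. There the power of two becomes
  \<open>2 ^ (k * d)\<close>, the reciprocal of the volume scaling of the \<open>k\<close>-th
  shell.\<close>

lemma critical_coefficient_powr_le:
  assumes d: "d \<ge> 2" and p: "1 \<le> p" "p \<le> real d / (real d - 1)" and k: "k \<ge> 1"
  shows "(2 ^ (k * (d - 1)) / real k) powr p
    \<le> (2 ^ k) ^ d * real k powr - (real d / (real d - 1))"
proof -
  define q where "q = real d / (real d - 1)"
  have "real k \<le> 2 ^ k" using less_exp[of k] by (metis less_imp_le of_nat_le_iff of_nat_numeral of_nat_power)
  also have "(2::real) ^ k \<le> 2 ^ (k * (d - 1))" using d by (intro power_increasing) auto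
  finally have "1 \<le> 2 ^ (k * (d - 1)) / real k" using k by simp
  then have "(2 ^ (k * (d - 1)) / real k) powr p \<le> (2 ^ (k * (d - 1)) / real k) powr q"
    using p by (intro powr_mono) (auto simp: q_def)
  also have "\<dots> = (2 ^ (k * (d - 1))) powr q * real k powr - q"
    by (simp add: powr_divide powr_minus_divide)
  also have "(2 ^ (k * (d - 1))) powr q = (2::real) powr (real (k * (d - 1)) * q)"
    by (simp add: powr_powr flip: powr_realpow)
  also have "real (k * (d - 1)) * q = real (k * d)"
    using d by (simp add: q_def of_nat_diff)
  also have "(2::real) powr real (k * d) = (2 ^ k) ^ d"
    by (simp only: powr_realpow power_mult zero_less_numeral)
  finally show ?thesis by (simp add: q_def)
qed

lemma critical_function_integrable_powr:
  assumes "p > 0"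
  shows "integrable lborel (\<lambda>y :: real ^ 'n. \<bar>critical_function R N y\<bar> powr p)"
  unfolding critical_function_powr[OF assms]
  by (intro Bochner_Integration.integrable_sum integrable_mult_right integrable_indicator_dyadic_shell)

lemma critical_function_integral_powr_le:
  assumes d: "CARD('n) \<ge> 2" and p: "1 \<le> p" "p \<le> real CARD('n) / (real CARD('n) - 1)"
    and R: "R > 0"
  shows "(LINT y|lborel. \<bar>critical_function R N (y :: real ^ 'n)\<bar> powr p)
    \<le> unit_ball_vol CARD('n) * R ^ CARD('n)
        * (\<Sum>k=1..N. real k powr - (real CARD('n) / (real CARD('n) - 1)))"
proof -
  have "p > 0" using p by simp
  have "(LINT y|lborel. \<bar>critical_function R N (y :: real ^ 'n)\<bar> powr p)
     = (\<Sum>k=1..N. (2 ^ (k * (CARD('n) - 1)) / real k) powr p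
          * measure lborel (dyadic_shell R k :: (real ^ 'n) set))"
    unfolding critical_function_powr[OF \<open>p > 0\<close>]
    by (subst Bochner_Integration.integral_sum)
       (auto intro!: integrable_mult_right integrable_indicator_dyadic_shell)
  also have "\<dots> \<le> (\<Sum>k=1..N. ((2 ^ k) ^ CARD('n) * real k powr - (real CARD('n) / (real CARD('n) - 1)))
          * (unit_ball_vol CARD('n) * (R / 2 ^ k) ^ CARD('n)))"
    using R by (intro sum_mono mult_mono critical_coefficient_powr_le measure_dyadic_shell_le d p) auto
  also have "\<dots> = unit_ball_vol CARD('n) * R ^ CARD('n)
        * (\<Sum>k=1..N. real k powr - (real CARD('n) / (real CARD('n) - 1)))"
    unfolding sum_distrib_left by (intro sum.cong) (simp_all add: power_divide)
  finally show ?thesis .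
qed

section \<open>Lower bound for the averages\<close>

text \<open>The \<open>k\<close>-th shell fills a proportion of order \<open>2 ^ k\<close> to the
  power \<open>1 - d\<close> of the annulus; the coefficient cancels this up to
  \<open>1 / k\<close>, and the sum over \<open>k\<close> is harmonic. The bound on
  \<open>e (norm x)\<close> is an eighth of \<open>R / 2 ^ N\<close>, the radius of the smallest
  shell, as the shell estimate requires.\<close>

lemma critical_function_average_ge:
  fixes x :: "real ^ 'n"
  assumes d: "CARD('n) \<ge> 2" and R: "R > 0" and x: "R \<le> norm x" "norm x \<le> 2 * R"
    and e: "0 < e (norm x)" "e (norm x) \<le> 1 / (8 * 2 ^ N) * R"
  shows "harm N / (2 * 4 ^ CARD('n) * 32 ^ (CARD('n) - 1))
    \<le> annular_average e (\<lambda>t \<omega>. \<omega> + t) (norm x) (critical_function R N) x"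
proof -
  define s where "s = e (norm x)"
  define m where "m = CARD('n) - 1"
  define A where "A = (annulus (norm x) s :: (real ^ 'n) set)"
  define V where "V = measure lborel A"
  define G where "G k = A \<inter> {t. x + t \<in> dyadic_shell R k}" for k
  have A: "A \<in> sets borel" unfolding A_def annulus_def by measurable
  have G: "G k \<in> sets borel" for k
    using A unfolding G_def dyadic_shell_def by measurable
  have "bounded (G k)" for k
    by (rule boundedI[of _ "norm x"]) (auto simp: G_def A_def annulus_def)
  then have G_int: "integrable lborel (indicator (G k) :: real ^ 'n \<Rightarrow> real)" for k
    using G emeasure_bounded_finite by (intro integrable_real_indicator) auto
  have s: "0 < s" "s \<le> R / 2 ^ N / 8" using e by (simp_all add: s_def)
  have "R / 2 ^ N \<le> R / 1" using R by (intro divide_left_mono) auto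
  then have "s \<le> R / 8" using s by simp
  then have "s < norm x" using x R by linarith
  then have V: "V > 0"
    unfolding V_def A_def using s x R d
    by (subst measure_annulus) (auto intro!: mult_pos_pos power_strict_mono)
  have "(LINT t:A|lborel. critical_function R N (x + t))
      = (LINT t|lborel. (\<Sum>k=1..N. 2 ^ (k * m) / real k * indicator (G k) t))"
    unfolding set_lebesgue_integral_def critical_function_def m_def
    by (intro Bochner_Integration.integral_cong)
       (auto simp: G_def sum_distrib_left indicator_def intro!: sum.cong)
  also have "\<dots> = (\<Sum>k=1..N. 2 ^ (k * m) / real k * measure lborel (G k))"
    using G_int G by (subst Bochner_Integration.integral_sum) auto
  finally have int: "(LINT t:A|lborel. critical_function R N (x + t))
      = (\<Sum>k=1..N. 2 ^ (k * m) / real k * measure lborel (G k))" .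
  have "inverse (real k) / (2 * 4 ^ CARD('n) * 32 ^ m) * V \<le> 2 ^ (k * m) / real k * measure lborel (G k)"
    if k: "k \<in> {1..N}" for k
  proof -
    define \<rho> where "\<rho> = R / 2 ^ k"
    have "(2::real) ^ k \<le> 2 ^ N" using k by (intro power_increasing) auto
    then have "R / 2 ^ N \<le> \<rho>" unfolding \<rho>_def using R by (intro divide_left_mono) auto
    then have s\<rho>: "s \<le> \<rho> / 8" using s by simp
    have "\<rho> \<le> R / 1" unfolding \<rho>_def using R by (intro divide_left_mono) auto
    then have \<rho>: "\<rho> \<le> norm x" using x by simp
    \<comment> \<open>The left side bounds \<open>R / norm x\<close> from below; its
      \<open>m\<close>-th power turns the constant 16 of the shell estimate into 32.\<close>
    have "1 / 2 \<le> 2 ^ k * (\<rho> / norm x)"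
    proof -
      have "norm x > 0" using x R by linarith
      then show ?thesis using x by (simp add: \<rho>_def pos_le_divide_eq)
    qed
    then have "(1 / 2) ^ m \<le> (2 ^ k * (\<rho> / norm x)) ^ m" by (intro power_mono) auto
    then have pow: "(1 / 2) ^ m \<le> 2 ^ (k * m) * (\<rho> / norm x) ^ m"
      by (simp only: power_mult_distrib power_mult)
    have "inverse (real k) / (2 * 4 ^ CARD('n) * 32 ^ m) * V
        = 1 / real k * ((1 / 2) ^ m) * (1 / (2 * 4 ^ CARD('n) * 16 ^ m) * V)"
    proof -
      have "(32::real) ^ m = 2 ^ m * 16 ^ m" by (simp flip: power_mult_distrib)
      then show ?thesis by (simp add: inverse_eq_divide power_divide)
    qed
    also have "\<dots> \<le> 1 / real k * (2 ^ (k * m) * (\<rho> / norm x) ^ m) * (1 / (2 * 4 ^ CARD('n) * 16 ^ m) * V)"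
      using pow V by (intro mult_right_mono mult_left_mono) auto
    also have "\<dots> = 2 ^ (k * m) / real k * ((\<rho> / norm x) ^ m / (2 * 4 ^ CARD('n) * 16 ^ m) * V)"
      by simp
    also have "\<dots> \<le> 2 ^ (k * m) / real k * measure lborel (G k)"
      using measure_annulus_Int_shell_ge[OF d s(1) s\<rho> \<rho>]
      unfolding V_def A_def G_def m_def dyadic_shell_def \<rho>_def by (intro mult_left_mono) auto
    finally show ?thesis .
  qed
  then have "(\<Sum>k=1..N. inverse (real k) / (2 * 4 ^ CARD('n) * 32 ^ m) * V)
      \<le> (LINT t:A|lborel. critical_function R N (x + t))"
    unfolding int by (rule sum_mono)
  then have "harm N / (2 * 4 ^ CARD('n) * 32 ^ m) * V
      \<le> (LINT t:A|lborel. critical_function R N (x + t))"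
    by (simp add: harm_def sum_distrib_right sum_divide_distrib)
  then show ?thesis
    using V unfolding annular_average_def m_def V_def A_def s_def
    by (simp add: field_simps)
qed

section \<open>The translation action and the contradiction\<close>

text \<open>For this system the averages at a point are means over annuli centred at that
  point.\<close>

lemma translation_measure_preserving_system:
  "measure_preserving_system lborel (\<lambda>(t :: real ^ 'n) \<omega>. \<omega> + t)"
proof -
  have "emeasure lborel ((\<lambda>\<omega>. \<omega> + t) -` A \<inter> space lborel) = emeasure lborel A"
    if "A \<in> sets lborel" for t :: "real ^ 'n" and A
  proof -
    have "emeasure lborel A = emeasure (distr lborel borel ((+) t)) A"
      by (simp add: lborel_distr_plus)
    also have "\<dots> = emeasure lborel ((+) t -` A \<inter> space lborel)"
      using that by (intro emeasure_distr) auto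
    also have "(+) t = (\<lambda>\<omega>. \<omega> + t)" by (auto simp: add.commute)
    finally show ?thesis by simp
  qed
  moreover have "(\<lambda>(t :: real ^ 'n, \<omega>). \<omega> + t) \<in> borel \<Otimes>\<^sub>M lborel \<rightarrow>\<^sub>M lborel"
    by (simp add: case_prod_beta)
  ultimately show ?thesis
    by unfold_locales (auto simp: algebra_simps)
qed

theorem theorem6:
  fixes e :: "real \<Rightarrow> real" and p :: real
  assumes "CARD('n::finite) \<ge> 2"
    and "\<And>r. r > 0 \<Longrightarrow> 0 < e r \<and> e r \<le> r"
    and "(mono_on {0<..} e \<and> (INF r\<in>{0<..}. e r / r) = 0)
         \<or> ((\<lambda>r. e r / r) \<longlongrightarrow> 0) at_top
         \<or> ((\<lambda>r. e r / r) \<longlongrightarrow> 0) (at_right 0)"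
    and "1 \<le> p"
    and "p \<le> real CARD('n) / (real CARD('n) - 1)"
  shows "\<not> weak_Lp_maximal_inequality TYPE(real ^ 'n) TYPE('n) e p"
proof
  assume "weak_Lp_maximal_inequality TYPE(real ^ 'n) TYPE('n) e p"
  then obtain C where "C \<ge> 0" and weak:
    "\<And>(M :: (real ^ 'n) measure) (T :: real ^ 'n \<Rightarrow> real ^ 'n \<Rightarrow> real ^ 'n) \<phi>.
      measure_preserving_system M T \<Longrightarrow> \<phi> \<in> borel_measurable M \<Longrightarrow>
      integrable M (\<lambda>\<omega>. \<bar>\<phi> \<omega>\<bar> powr p) \<Longrightarrow>
      outer_measure_of M
          {\<omega> \<in> space M. (SUP r\<in>{0<..}. ennreal \<bar>annular_average e T r \<phi> \<omega>\<bar>) > 1}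
        \<le> ennreal (C * (LINT \<omega>|M. \<bar>\<phi> \<omega>\<bar> powr p))"
    unfolding weak_Lp_maximal_inequality_def by blast
  define q where "q = real CARD('n) / (real CARD('n) - 1)"
  have "q > 1" using assms(1) by (simp add: q_def field_simps)
  then have summ: "summable (\<lambda>k. real k powr - q)" by (simp add: summable_real_powr_iff)
  define Z where "Z = (\<Sum>k. real k powr - q)"
  have Z: "(\<Sum>k=1..N. real k powr - q) \<le> Z" for N
    unfolding Z_def by (intro sum_le_suminf summ) auto
  have "Z \<ge> 0" using Z[of 0] by simp
  define c where "c = 1 / (2 * 4 ^ CARD('n) * 32 ^ (CARD('n) - 1) :: real)"
  have "c > 0" by (simp add: c_def)
  \<comment> \<open>The number of shells is fixed by \<open>C\<close> alone, before the scale
    \<open>R\<close>, because \<open>Z\<close> bounds the sums for every \<open>N\<close>. The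
    summand 1 makes \<open>harm N\<close> positive and the later comparison strict.\<close>
  have "\<forall>\<^sub>F N in sequentially. 2 / c * (1 + C * Z) + 1 \<le> harm N"
    using harm_at_top by (simp add: filterlim_at_top)
  then obtain N where N: "2 / c * (1 + C * Z) + 1 \<le> harm N"
    by (auto simp: eventually_sequentially)
  have "2 / c * (1 + C * Z) \<ge> 0" using \<open>c > 0\<close> \<open>C \<ge> 0\<close> \<open>Z \<ge> 0\<close> by simp
  then have harm: "harm N > (0::real)" using N by linarith
  \<comment> \<open>The averages of the test function are at least \<open>c * harm N\<close>, so the
    factor \<open>B\<close> lifts them to 2, safely above the threshold 1.\<close>
  define B where "B = 2 / (c * harm N)"
  have "B > 0" using \<open>c > 0\<close> harm by (simp add: B_def)
  have "2 / c * (1 + C * Z) < harm N" using N by linarith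
  then have "2 / c * (1 + C * Z) / harm N < 1" using harm by (subst divide_less_eq_1_pos)
  then have B: "B * (1 + C * Z) < 1" by (simp add: B_def)
  moreover have "0 \<le> B * (C * Z)" using \<open>B > 0\<close> \<open>C \<ge> 0\<close> \<open>Z \<ge> 0\<close> by simp
  ultimately have "B \<le> 1" "B * (C * Z) < 1" using \<open>B > 0\<close> by (simp_all add: algebra_simps)
  obtain R where R: "R > 0" "\<And>r. R \<le> r \<Longrightarrow> r \<le> 2 * R \<Longrightarrow> e r \<le> 1 / (8 * 2 ^ N) * R"
    using exists_thin_scale[OF assms(2,3), of "1 / (8 * 2 ^ N)"] by auto
  define g where "g = (critical_function R N :: real ^ 'n \<Rightarrow> real)"
  define T where "T = (\<lambda>(t :: real ^ 'n) \<omega>. \<omega> + t)"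
  let ?E = "{\<omega> \<in> space lborel. (SUP r\<in>{0<..}. ennreal \<bar>annular_average e T r (\<lambda>y. B * g y) \<omega>\<bar>) > 1}"
  have powr: "\<bar>B * g y\<bar> powr p = B powr p * \<bar>g y\<bar> powr p" for y
    using \<open>B > 0\<close> by (simp add: abs_mult powr_mult)
  have g: "integrable lborel (\<lambda>y. \<bar>g y\<bar> powr p)"
    unfolding g_def using assms(4) by (intro critical_function_integrable_powr) simp
  \<comment> \<open>Each \<open>x\<close> is tested with its own radius \<open>norm x\<close>, for
    which the annulus around \<open>x\<close> reaches the origin.\<close>
  have "annulus (2 * R) R \<subseteq> ?E"
  proof
    fix x :: "real ^ 'n" assume "x \<in> annulus (2 * R) R"
    then have x: "R \<le> norm x" "norm x \<le> 2 * R" by (auto simp: annulus_def)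
    have "norm x > 0" using x R(1) by linarith
    have "2 = B * (c * harm N)" using \<open>c > 0\<close> harm by (simp del: harm_pos_iff add: B_def)
    also have "\<dots> \<le> B * annular_average e T (norm x) g x"
      using critical_function_average_ge[OF assms(1) R(1) x, of e N] assms(2) R(2)[OF x]
        \<open>norm x > 0\<close> \<open>B > 0\<close>
      unfolding g_def T_def c_def by (intro mult_left_mono) auto
    also have "\<dots> = annular_average e T (norm x) (\<lambda>y. B * g y) x"
      by (simp add: annular_average_def)
    finally have "(1::ennreal) < ennreal \<bar>annular_average e T (norm x) (\<lambda>y. B * g y) x\<bar>"
      by simp
    also have "\<dots> \<le> (SUP r\<in>{0<..}. ennreal \<bar>annular_average e T r (\<lambda>y. B * g y) x\<bar>)"
      using \<open>norm x > 0\<close> by (intro SUP_upper) auto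
    finally show "x \<in> ?E" by simp
  qed
  moreover have "(annulus (2 * R) R :: (real ^ 'n) set) \<in> sets lborel"
    unfolding annulus_def by simp
  ultimately have "emeasure lborel (annulus (2 * R) R :: (real ^ 'n) set) \<le> outer_measure_of lborel ?E"
    using outer_measure_of_mono[of "annulus (2 * R) R" ?E lborel] by simp
  also have "\<dots> \<le> ennreal (C * (LINT y|lborel. \<bar>B * g y\<bar> powr p))"
  proof (rule weak)
    show "measure_preserving_system lborel T"
      unfolding T_def by (rule translation_measure_preserving_system)
    show "integrable lborel (\<lambda>y. \<bar>B * g y\<bar> powr p)"
      unfolding powr using g by simp
  qed (simp add: g_def)
  finally have "measure lborel (annulus (2 * R) R :: (real ^ 'n) set)
      \<le> C * (LINT y|lborel. \<bar>B * g y\<bar> powr p)"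
    using \<open>C \<ge> 0\<close> unfolding measure_def by (intro enn2real_leI) auto
  also have "\<dots> = C * (B powr p * (LINT y|lborel. \<bar>g y\<bar> powr p))"
    unfolding powr by simp
  also have "\<dots> \<le> C * (B * (unit_ball_vol CARD('n) * R ^ CARD('n) * Z))"
  proof (intro mult_left_mono mult_mono)
    \<comment> \<open>As \<open>B \<le> 1\<close> and \<open>p \<ge> 1\<close>, a bound linear in
      \<open>B\<close> serves for every \<open>p\<close>.\<close>
    show "B powr p \<le> B" using powr_mono'[of 1 p B] assms(4) \<open>B > 0\<close> \<open>B \<le> 1\<close> by simp
    have "(LINT y|lborel. \<bar>g y\<bar> powr p) \<le> unit_ball_vol CARD('n) * R ^ CARD('n) * (\<Sum>k=1..N. real k powr - q)"
      unfolding g_def q_def by (rule critical_function_integral_powr_le[OF assms(1,4,5) R(1)])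
    also have "\<dots> \<le> unit_ball_vol CARD('n) * R ^ CARD('n) * Z"
      using R(1) Z by (intro mult_left_mono) auto
    finally show "(LINT y|lborel. \<bar>g y\<bar> powr p) \<le> unit_ball_vol CARD('n) * R ^ CARD('n) * Z" .
  qed (use \<open>B > 0\<close> \<open>C \<ge> 0\<close> in auto)
  also have "\<dots> = B * (C * Z) * (R ^ CARD('n) * unit_ball_vol CARD('n))" by simp
  also have "\<dots> < 1 * (R ^ CARD('n) * unit_ball_vol CARD('n))"
    using \<open>B * (C * Z) < 1\<close> R(1) by (intro mult_strict_right_mono) auto
  \<comment> \<open>The annulus \<open>R \<le> norm x \<le> 2 * R\<close> has at least the volume of
    the ball of radius \<open>R\<close>, whereas the inequality left it strictly less.\<close>
  also have "\<dots> \<le> ((2 * R) ^ CARD('n) - R ^ CARD('n)) * unit_ball_vol CARD('n)"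
  proof -
    have "(2::real) ^ 1 \<le> 2 ^ CARD('n)" using assms(1) by (intro power_increasing) auto
    then have "2 * R ^ CARD('n) \<le> 2 ^ CARD('n) * R ^ CARD('n)"
      using R(1) by (intro mult_right_mono) auto
    then have "R ^ CARD('n) \<le> (2 * R) ^ CARD('n) - R ^ CARD('n)"
      by (simp add: power_mult_distrib)
    then have "R ^ CARD('n) * unit_ball_vol CARD('n)
        \<le> ((2 * R) ^ CARD('n) - R ^ CARD('n)) * unit_ball_vol CARD('n)"
      by (rule mult_right_mono) simp
    then show ?thesis by simp
  qed
  also have "\<dots> = measure lborel (annulus (2 * R) R :: (real ^ 'n) set)"
    using measure_annulus[of R "2 * R", where 'n='n] R(1) by simp
  finally show False by simp
qed

end
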